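(* Let $\sigma_1,\sigma_2$ be weight functions on $T$, let $\varphi:T\to T$ be a self map and $\psi:T\to\mathbb{C}$ a function, and set $\Psi=\psi/(\sigma_1\circ\varphi)$. For $0<p\le\infty$, the operator $W_{\psi,\varphi}:\mathbb{T}_{\sigma_1,\infty}\to\mathbb{T}_{\sigma_2,p}$, $W_{\psi,\varphi}(f)=\psi\,(f\circ\varphi)$, is bounded if and only if $\Psi\in\mathbb{T}_{\sigma_2,p}$. In this case, $\|W_{\psi,\varphi}\|=\|\Psi\|_{\sigma_2,p}$.
   Context: $T$ is an infinite rooted tree, identified with its vertex set; $|x|$ is the edge-counting distance from the root $o$ to the vertex $x$; $D_n=\{x\in T:|x|=n\}$ and $c_n$ is the number of elements of $D_n$ for $n\in\mathbb{N}_0=\{0,1,2,\dots\}$. Standing assumptions: every $c_n$ is finite and the sequence $\{c_n\}$ is unbounded. A weight function is a function $\sigma:T\to(0,\infty)$. For a weight $\sigma$, $0<p<\infty$ and $f:T\to\mathbb{C}$, put $M_{\sigma,p}(n,f)=\left(\frac{1}{c_n}\sum_{|x|=n}\sigma(x)^p|f(x)|^p\right)^{1/p}$ and $\|f\|_{\sigma,p}=\sup_{n\in\mathbb{N}_0}M_{\sigma,p}(n,f)$; for $p=\infty$ put $\|f\|_{\sigma,\infty}=\sup_{x\in T}\sigma(x)|f(x)|$. The space $\mathbb{T}_{\sigma,p}$ is the set of all $f:T\to\mathbb{C}$ with $\|f\|_{\sigma,p}<\infty$. A linear operator $A:X\to Y$ between such spaces is bounded if it maps $X$ into $Y$ and $\|Af\|_Y\le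 C\|f\|_X$ for some constant $C$ and all $f\in X$; $\|A\|$ is the least such $C$. *)

theory Defs
  imports "HOL-Analysis.Analysis"
begin

text \<open>
  The vertex set of the tree is the whole type \<open>'v\<close>, so functions on the tree are
  the functions on \<open>'v\<close>.  A graph is given by its adjacency relation, and a walk by
  the nonempty list of the vertices it visits.
\<close>

definition walk_between :: "('v \<Rightarrow> 'v \<Rightarrow> bool) \<Rightarrow> 'v \<Rightarrow> 'v \<Rightarrow> 'v list \<Rightarrow> bool" where
  "walk_between adj x y xs \<longleftrightarrow> xs \<noteq> [] \<and> successively adj xs \<and> hd xs = x \<and> last xs = y"

definition simple_graph :: "('v \<Rightarrow> 'v \<Rightarrow> bool) \<Rightarrow> bool" where
  "simple_graph adj \<longleftrightarrow> symp adj \<and> irreflp adj"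

definition graph_connected :: "('v \<Rightarrow> 'v \<Rightarrow> bool) \<Rightarrow> bool" where
  "graph_connected adj \<longleftrightarrow> (\<forall>x y. \<exists>xs. walk_between adj x y xs)"

definition graph_cycle :: "('v \<Rightarrow> 'v \<Rightarrow> bool) \<Rightarrow> 'v list \<Rightarrow> bool" where
  "graph_cycle adj xs \<longleftrightarrow>
     3 \<le> length xs \<and> distinct xs \<and> successively adj xs \<and> adj (last xs) (hd xs)"

definition is_tree :: "('v \<Rightarrow> 'v \<Rightarrow> bool) \<Rightarrow> bool" where
  "is_tree adj \<longleftrightarrow> simple_graph adj \<and> graph_connected adj \<and> (\<nexists>xs. graph_cycle adj xs)"

text \<open>A walk visiting \<open>Suc n\<close> vertices has \<open>n\<close> edges.\<close>

definition graph_dist :: "('v \<Rightarrow> 'v \<Rightarrow> bool) \<Rightarrow> 'v \<Rightarrow> 'v \<Rightarrow> nat" where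
  "graph_dist adj x y = (LEAST n. \<exists>xs. walk_between adj x y xs \<and> length xs = Suc n)"

definition sphere_at :: "('v \<Rightarrow> 'v \<Rightarrow> bool) \<Rightarrow> 'v \<Rightarrow> nat \<Rightarrow> 'v set" where
  "sphere_at adj r n = {x. graph_dist adj r x = n}"

definition admissible_tree :: "('v \<Rightarrow> 'v \<Rightarrow> bool) \<Rightarrow> 'v \<Rightarrow> bool" where
  "admissible_tree adj r \<longleftrightarrow>
     is_tree adj \<and> infinite (UNIV :: 'v set) \<and>
     (\<forall>n. finite (sphere_at adj r n)) \<and>
     \<not> bdd_above (range (\<lambda>n. card (sphere_at adj r n)))"

definition weight_function :: "('v \<Rightarrow> real) \<Rightarrow> bool" where
  "weight_function \<sigma> \<longleftrightarrow> (\<forall>x. 0 < \<sigma> x)"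

definition mean_p ::
  "('v \<Rightarrow> 'v \<Rightarrow> bool) \<Rightarrow> 'v \<Rightarrow> ('v \<Rightarrow> real) \<Rightarrow> real \<Rightarrow> nat \<Rightarrow> ('v \<Rightarrow> complex) \<Rightarrow> real" where
  "mean_p adj r \<sigma> p n f =
     (1 / real (card (sphere_at adj r n)) *
        (\<Sum>x\<in>sphere_at adj r n. \<sigma> x powr p * cmod (f x) powr p)) powr (1 / p)"

text \<open>
  The exponent \<open>p\<close> is meant to satisfy \<open>0 < p\<close>.  The value is extended nonnegative, so that
  an infinite supremum is the value \<open>\<infinity>\<close>.
\<close>

definition weighted_norm ::
  "('v \<Rightarrow> 'v \<Rightarrow> bool) \<Rightarrow> 'v \<Rightarrow> ('v \<Rightarrow> real) \<Rightarrow> ennreal \<Rightarrow> ('v \<Rightarrow> complex) \<Rightarrow> ennreal" where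
  "weighted_norm adj r \<sigma> p f =
     (if p = \<infinity> then (SUP x. ennreal (\<sigma> x * cmod (f x)))
      else (SUP n. ennreal (mean_p adj r \<sigma> (enn2real p) n f)))"

definition weighted_space ::
  "('v \<Rightarrow> 'v \<Rightarrow> bool) \<Rightarrow> 'v \<Rightarrow> ('v \<Rightarrow> real) \<Rightarrow> ennreal \<Rightarrow> ('v \<Rightarrow> complex) set" where
  "weighted_space adj r \<sigma> p = {f. weighted_norm adj r \<sigma> p f < \<infinity>}"

text \<open>
  In the next three definitions \<open>X\<close> and \<open>Y\<close> are spaces with norms \<open>NX\<close> and \<open>NY\<close>.
\<close>

definition operator_bound ::
  "'a set \<Rightarrow> ('a \<Rightarrow> ennreal) \<Rightarrow> ('b \<Rightarrow> ennreal) \<Rightarrow> ('a \<Rightarrow> 'b) \<Rightarrow> real \<Rightarrow> bool" where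
  "operator_bound X NX NY A C \<longleftrightarrow> 0 \<le> C \<and> (\<forall>f\<in>X. NY (A f) \<le> ennreal C * NX f)"

definition bounded_operator ::
  "'a set \<Rightarrow> ('a \<Rightarrow> ennreal) \<Rightarrow> 'b set \<Rightarrow> ('b \<Rightarrow> ennreal) \<Rightarrow> ('a \<Rightarrow> 'b) \<Rightarrow> bool" where
  "bounded_operator X NX Y NY A \<longleftrightarrow> A ` X \<subseteq> Y \<and> (\<exists>C. operator_bound X NX NY A C)"

definition operator_norm ::
  "'a set \<Rightarrow> ('a \<Rightarrow> ennreal) \<Rightarrow> ('b \<Rightarrow> ennreal) \<Rightarrow> ('a \<Rightarrow> 'b) \<Rightarrow> real" where
  "operator_norm X NX NY A = (LEAST C. operator_bound X NX NY A C)"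

definition weighted_composition ::
  "('v \<Rightarrow> complex) \<Rightarrow> ('v \<Rightarrow> 'v) \<Rightarrow> ('v \<Rightarrow> complex) \<Rightarrow> ('v \<Rightarrow> complex)" where
  "weighted_composition \<psi> \<phi> f = (\<lambda>x. \<psi> x * (f \<circ> \<phi>) x)"

lemma weighted_composition_linear:
  "weighted_composition \<psi> \<phi> (\<lambda>x. a * f x + b * g x) =
     (\<lambda>x. a * weighted_composition \<psi> \<phi> f x + b * weighted_composition \<psi> \<phi> g x)"
  by (simp add: weighted_composition_def fun_eq_iff algebra_simps)

end

theory Submission
  imports Defs
begin

text \<open>
  The reciprocal of the source weight has norm one and is mapped to \<open>\<Psi>\<close>.  It is extremal:
  every \<open>f\<close> of norm \<open>K\<close> satisfies \<open>cmod (f x) \<le> K / \<sigma>\<^sub>1 x\<close>, so its image is dominated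
  pointwise by \<open>K * cmod (\<Psi> x)\<close>.
\<close>

lemma mean_p_nonneg: "0 \<le> mean_p adj r \<sigma> p n f"
  by (simp add: mean_p_def)

text \<open>Only monotonicity and homogeneity of powers enter, with no triangle inequality, so
  exponents below 1 are covered. If the sphere is empty or infinite, its \<open>card\<close> is 0
  and the default \<open>1 / 0 = 0\<close> makes both means 0.\<close>

lemma mean_p_scale:
  assumes "0 < p" "0 \<le> K" "\<And>x. cmod (g x) \<le> K * cmod (f x)"
  shows "mean_p adj r \<sigma> p n g \<le> K * mean_p adj r \<sigma> p n f"
proof -
  let ?D = "sphere_at adj r n"
  let ?S = "\<lambda>h. 1 / real (card ?D) * (\<Sum>x\<in>?D. \<sigma> x powr p * cmod (h x) powr p)"
  have S_nonneg: "0 \<le> ?S h" for h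
    by (intro mult_nonneg_nonneg sum_nonneg) auto
  have term_le: "\<sigma> x powr p * cmod (g x) powr p \<le> K powr p * (\<sigma> x powr p * cmod (f x) powr p)" for x
  proof -
    have "cmod (g x) powr p \<le> (K * cmod (f x)) powr p"
      using assms by (intro powr_mono2) auto
    also have "\<dots> = K powr p * cmod (f x) powr p"
      using assms by (simp add: powr_mult)
    finally show ?thesis
      by (metis mult.left_commute mult_left_mono powr_ge_zero)
  qed
  have "?S g \<le> 1 / real (card ?D) * (\<Sum>x\<in>?D. K powr p * (\<sigma> x powr p * cmod (f x) powr p))"
    by (intro mult_left_mono sum_mono term_le) auto
  also have "\<dots> = K powr p * ?S f"
    by (simp add: sum_distrib_left)
  finally have "?S g powr (1 / p) \<le> (K powr p * ?S f) powr (1 / p)"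
    using assms S_nonneg by (intro powr_mono2) auto
  also have "\<dots> = (K powr p) powr (1 / p) * ?S f powr (1 / p)"
    by (rule powr_mult)
  \<comment> \<open>This includes \<open>K = 0\<close>, because \<open>0 powr p\<close> is
    0.\<close>
  also have "(K powr p) powr (1 / p) = K"
    using assms by (simp add: powr_powr)
  finally show ?thesis
    by (simp add: mean_p_def)
qed

text \<open>The pointwise domination passes to each term of the supremum, and in
  \<open>ennreal\<close> a constant factor can be pulled out of a supremum even when that is
  infinite. For \<open>K = 0\<close> the convention \<open>0 * \<infinity> = 0\<close> is harmless,
  since then \<open>g\<close> vanishes.\<close>

lemma weighted_norm_scale:
  assumes "weight_function \<sigma>" "0 < p" "0 \<le> K" "\<And>x. cmod (g x) \<le> K * cmod (f x)"
  shows "weighted_norm adj r \<sigma> p g \<le> ennreal K * weighted_norm adj r \<sigma> p f"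
proof (cases "p = \<infinity>")
  case True
  have "ennreal (\<sigma> x * cmod (g x)) \<le> ennreal K * ennreal (\<sigma> x * cmod (f x))" for x
  proof -
    have "0 \<le> \<sigma> x"
      using assms(1) by (simp add: weight_function_def less_imp_le)
    then have "\<sigma> x * cmod (g x) \<le> K * (\<sigma> x * cmod (f x))"
      by (metis assms(4) mult.left_commute mult_left_mono)
    then show ?thesis
      using assms(3) \<open>0 \<le> \<sigma> x\<close> by (simp add: ennreal_mult[symmetric])
  qed
  then show ?thesis
    using True by (auto simp: weighted_norm_def SUP_mult_left_ennreal intro!: SUP_mono)
next
  case False
  then have "0 < enn2real p"
    using assms(2) by (simp add: enn2real_positive_iff top.not_eq_extremum)
  then have "ennreal (mean_p adj r \<sigma> (enn2real p) n g)
      \<le> ennreal K * ennreal (mean_p adj r \<sigma> (enn2real p) n f)" for n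
    using assms by (simp add: mean_p_scale mean_p_nonneg flip: ennreal_mult)
  then show ?thesis
    using False by (auto simp: weighted_norm_def SUP_mult_left_ennreal intro!: SUP_mono)
qed

text \<open>Each \<open>\<sigma> x * cmod (f x)\<close> is a term of the supremum. Membership in the
  space makes that supremum finite; an infinite one would be sent to 0 by
  \<open>enn2real\<close>.\<close>

lemma cmod_le_weighted_norm_infinity:
  assumes "weight_function \<sigma>" "f \<in> weighted_space adj r \<sigma> \<infinity>"
  shows "cmod (f x) \<le> enn2real (weighted_norm adj r \<sigma> \<infinity> f) / \<sigma> x"
proof -
  have pos: "0 < \<sigma> x"
    using assms(1) by (simp add: weight_function_def)
  have "ennreal (\<sigma> x * cmod (f x)) \<le> weighted_norm adj r \<sigma> \<infinity> f"
    by (auto simp: weighted_norm_def intro: SUP_upper)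
  then have "\<sigma> x * cmod (f x) \<le> enn2real (weighted_norm adj r \<sigma> \<infinity> f)"
    using assms(2) pos enn2real_mono by (fastforce simp: weighted_space_def)
  then show ?thesis
    using pos by (simp add: field_simps)
qed

lemma weighted_norm_infinity_inverse_weight:
  assumes "weight_function \<sigma>"
  shows "weighted_norm adj r \<sigma> \<infinity> (\<lambda>x. 1 / complex_of_real (\<sigma> x)) = 1"
proof -
  have "\<sigma> x * cmod (1 / complex_of_real (\<sigma> x)) = 1" for x
    using assms by (simp add: weight_function_def norm_divide abs_of_pos less_imp_neq[THEN not_sym])
  then show ?thesis
    by (simp add: weighted_norm_def)
qed

text \<open>The norm of \<open>f\<close> serves as the scalar and \<open>\<Psi>\<close> as the
  dominating function in \<open>weighted_norm_scale\<close>. The norm of \<open>\<Psi>\<close> may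
  be infinite here.\<close>

lemma weighted_composition_norm_le:
  assumes "weight_function \<sigma>\<^sub>1" "weight_function \<sigma>\<^sub>2" "0 < p"
    and "f \<in> weighted_space adj r \<sigma>\<^sub>1 \<infinity>"
  shows "weighted_norm adj r \<sigma>\<^sub>2 p (weighted_composition \<psi> \<phi> f)
    \<le> weighted_norm adj r \<sigma>\<^sub>2 p (\<lambda>x. \<psi> x / complex_of_real ((\<sigma>\<^sub>1 \<circ> \<phi>) x))
        * weighted_norm adj r \<sigma>\<^sub>1 \<infinity> f"
proof -
  let ?\<Psi> = "\<lambda>x. \<psi> x / complex_of_real ((\<sigma>\<^sub>1 \<circ> \<phi>) x)"
  let ?K = "enn2real (weighted_norm adj r \<sigma>\<^sub>1 \<infinity> f)"
  have "cmod (weighted_composition \<psi> \<phi> f x) \<le> ?K * cmod (?\<Psi> x)" for x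
  proof -
    have "0 < \<sigma>\<^sub>1 (\<phi> x)"
      using assms(1) by (simp add: weight_function_def)
    \<comment> \<open>The bound on \<open>f\<close> is taken at the point \<open>\<phi> x\<close>;
      its factor \<open>1 / \<sigma>\<^sub>1 (\<phi> x)\<close> turns \<open>\<psi>\<close> into
      \<open>\<Psi>\<close>.\<close>
    moreover have "cmod (\<psi> x) * cmod (f (\<phi> x)) \<le> cmod (\<psi> x) * (?K / \<sigma>\<^sub>1 (\<phi> x))"
      by (intro mult_left_mono cmod_le_weighted_norm_infinity assms) auto
    ultimately show ?thesis
      by (simp add: weighted_composition_def norm_mult norm_divide mult.commute)
  qed
  then have "weighted_norm adj r \<sigma>\<^sub>2 p (weighted_composition \<psi> \<phi> f)
      \<le> ennreal ?K * weighted_norm adj r \<sigma>\<^sub>2 p ?\<Psi>"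
    using assms by (intro weighted_norm_scale) auto
  then show ?thesis
    using assms(4) by (simp add: weighted_space_def mult.commute)
qed

theorem theorem4:
  fixes adj :: "'v \<Rightarrow> 'v \<Rightarrow> bool" and r :: 'v
    and \<sigma>\<^sub>1 \<sigma>\<^sub>2 :: "'v \<Rightarrow> real"
    and \<phi> :: "'v \<Rightarrow> 'v" and \<psi> \<Psi> :: "'v \<Rightarrow> complex"
    and p :: ennreal
  assumes "admissible_tree adj r"
    and "weight_function \<sigma>\<^sub>1" and "weight_function \<sigma>\<^sub>2"
    and "0 < p"
    and "\<Psi> = (\<lambda>x. \<psi> x / complex_of_real ((\<sigma>\<^sub>1 \<circ> \<phi>) x))"
  shows "(bounded_operator
            (weighted_space adj r \<sigma>\<^sub>1 \<infinity>) (weighted_norm adj r \<sigma>\<^sub>1 \<infinity>)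
            (weighted_space adj r \<sigma>\<^sub>2 p) (weighted_norm adj r \<sigma>\<^sub>2 p)
            (weighted_composition \<psi> \<phi>)
          \<longleftrightarrow> \<Psi> \<in> weighted_space adj r \<sigma>\<^sub>2 p) \<and>
         (\<Psi> \<in> weighted_space adj r \<sigma>\<^sub>2 p \<longrightarrow>
            ennreal (operator_norm
              (weighted_space adj r \<sigma>\<^sub>1 \<infinity>) (weighted_norm adj r \<sigma>\<^sub>1 \<infinity>)
              (weighted_norm adj r \<sigma>\<^sub>2 p) (weighted_composition \<psi> \<phi>))
            = weighted_norm adj r \<sigma>\<^sub>2 p \<Psi>)"
proof -
  let ?X = "weighted_space adj r \<sigma>\<^sub>1 \<infinity>"
  let ?NX = "weighted_norm adj r \<sigma>\<^sub>1 \<infinity>"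
  let ?Y = "weighted_space adj r \<sigma>\<^sub>2 p"
  let ?NY = "weighted_norm adj r \<sigma>\<^sub>2 p"
  let ?W = "weighted_composition \<psi> \<phi>"
  let ?f = "\<lambda>x. 1 / complex_of_real (\<sigma>\<^sub>1 x)"
  have norm_f: "?NX ?f = 1"
    using assms(2) by (rule weighted_norm_infinity_inverse_weight)
  then have f_in: "?f \<in> ?X"
    by (simp add: weighted_space_def)
  have W_f: "?W ?f = \<Psi>"
    by (simp add: assms(5) weighted_composition_def)
  have W_le: "?NY (?W f) \<le> ?NY \<Psi> * ?NX f" if "f \<in> ?X" for f
    unfolding assms(5) using assms that by (intro weighted_composition_norm_le)
  \<comment> \<open>The admissible constants are exactly the reals in
    \<open>[?NY \<Psi>, \<infinity>)\<close>, an empty set if that norm is infinite. Testing on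
    \<open>?f\<close>, of norm 1, gives one direction and \<open>W_le\<close> the other.\<close>
  have bound_iff: "operator_bound ?X ?NX ?NY ?W C \<longleftrightarrow> 0 \<le> C \<and> ?NY \<Psi> \<le> ennreal C" for C
  proof
    assume "operator_bound ?X ?NX ?NY ?W C"
    then show "0 \<le> C \<and> ?NY \<Psi> \<le> ennreal C"
      using f_in W_f norm_f unfolding operator_bound_def by (metis mult.right_neutral)
  next
    assume "0 \<le> C \<and> ?NY \<Psi> \<le> ennreal C"
    then show "operator_bound ?X ?NX ?NY ?W C"
      unfolding operator_bound_def by (meson W_le mult_right_mono order_trans zero_le)
  qed
  have norm_eq: "ennreal (enn2real (?NY \<Psi>)) = ?NY \<Psi>" if "\<Psi> \<in> ?Y"
    using that by (simp add: weighted_space_def)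
  show ?thesis
  proof (intro conjI iffI impI)
    assume "bounded_operator ?X ?NX ?Y ?NY ?W"
    \<comment> \<open>\<open>\<Psi>\<close> is itself the image of \<open>?f\<close>, so it lies in
      the target space.\<close>
    then show "\<Psi> \<in> ?Y"
      using f_in W_f unfolding bounded_operator_def by blast
  next
    assume \<Psi>: "\<Psi> \<in> ?Y"
    have "?W f \<in> ?Y" if "f \<in> ?X" for f
    proof -
      have "?NY \<Psi> * ?NX f < \<infinity>"
        using \<Psi> that by (simp add: weighted_space_def ennreal_mult_less_top)
      then show ?thesis
        using W_le[OF that] by (simp add: weighted_space_def)
    qed
    moreover have "operator_bound ?X ?NX ?NY ?W (enn2real (?NY \<Psi>))"
      unfolding bound_iff using norm_eq[OF \<Psi>] by simp
    ultimately show "bounded_operator ?X ?NX ?Y ?NY ?W"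
      unfolding bounded_operator_def by blast
  next
    assume \<Psi>: "\<Psi> \<in> ?Y"
    have "operator_norm ?X ?NX ?NY ?W = enn2real (?NY \<Psi>)"
      unfolding operator_norm_def
    proof (rule Least_equality)
      show "operator_bound ?X ?NX ?NY ?W (enn2real (?NY \<Psi>))"
        unfolding bound_iff using norm_eq[OF \<Psi>] by simp
    next
      fix C
      assume "operator_bound ?X ?NX ?NY ?W C"
      \<comment> \<open>The clause \<open>0 \<le> C\<close> matters when
        \<open>?NY \<Psi> = 0\<close>: \<open>ennreal\<close> sends negative reals to 0, so without
        it every negative \<open>C\<close> would qualify and no least bound would exist.\<close>
      then show "enn2real (?NY \<Psi>) \<le> C"
        unfolding bound_iff by (simp add: enn2real_leI)
    qed
    then show "ennreal (operator_norm ?X ?NX ?NY ?W) = ?NY \<Psi>"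
      using norm_eq[OF \<Psi>] by simp
  qed
qed

end
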